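(* Let $N\ge1$, $0<\epsilon<1$, $\mathcal{D}_1=\{z\in\mathbb{C}:1-\epsilon<|z|<1+\epsilon\}$ and $\mathcal{D}_2=\mathcal{D}_1\times\mathcal{D}_1$. Let $\hat C^{abc}(v,w)$ ($a,b,c\in\{1,\dots,N\}$) be holomorphic on $\mathcal{D}_2$ and $\hat D^{ab}(z)$ ($a,b\in\{1,\dots,N\}$) be holomorphic on $\mathcal{D}_1$, with $\hat D^{ab}(1)=0$ for all $a,b$, and suppose that the Leibniz rule holds: for all $a,b,c$ and all $v,w\in\mathcal{D}_1$ with $vw\in\mathcal{D}_1$, $$\sum_{d=1}^N\hat C^{abd}(v,w)\hat D^{dc}(vw)=\sum_{d=1}^N\hat C^{dbc}(v,w)\hat D^{ad}(v)+\sum_{d=1}^N\hat C^{adc}(v,w)\hat D^{bd}(w).$$ Define $N\times N$ matrices $(M^b(v,w))_{ac}=\hat C^{abc}(v,w)$ and $(D(z))_{ab}=\hat D^{ab}(z)$. Fix $b\in\{1,\dots,N\}$ and let $\gamma$ be a piecewise smooth path in $\mathcal{D}_1$ from $1$ to a point $v$ such that $M^b(v',1)$ is invertible for every $v'$ on $\gamma$. Then, with all integrals taken along $\gamma$, $$D(v)=\int_1^v\frac{dv'}{v'}\,U(v,v')\,X(v')\,U(v,v')^{-1},$$ where $$U(v,v')=P\exp\Big\{-\int_{v'}^v\frac{dv''}{v''}M^b(v'',1)^{-1}\,\partial_wM^b(v'',w)\big|_{w=1}\Big\},\qquad X(v')=\sum_{d=1}^N\hat D'^{\,bd}(1)\,M^b(v',1)^{-1}M^d(v',1),$$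 and $\hat D'^{\,bd}(1)=\partial_w\hat D^{bd}(w)|_{w=1}$. (No summation over the fixed index $b$.) Thus $D(v)$ is determined by $M^d(v',1)$, $\partial_wM^b(v',w)|_{w=1}$ and the initial values $\hat D'^{\,bd}(1)$.
   Context: The functions $\hat C^{abc}(v,w)=\sum_{k,l\in\mathbb{Z}}C^{abc}(k,l)v^kw^l$ and $\hat D^{ab}(z)=\sum_{m\in\mathbb{Z}}D^{ab}(m)z^m$ encode a translation-invariant local product rule $(\phi\cdot\psi)^c_n=\sum_{l,m}\sum_{a,b}C^{abc}(l-n,m-n)\phi^a_l\psi^b_m$ and difference operator $(D\phi)^b_n=\sum_m\sum_a D^{ab}(m-n)\phi^a_m$ on $N$-flavor lattice fields on $\mathbb{Z}$; the Leibniz rule above is the Fourier form of $D(\phi\cdot\psi)=(D\phi)\cdot\psi+\phi\cdot(D\psi)$. $P\exp$ denotes the path-ordered exponential along $\gamma$: writing $A(v)=M^b(v,1)^{-1}\partial_wM^b(v,w)|_{w=1}$, $U(v,v')$ is the invertible matrix solution along $\gamma$ of $v\,\partial_vU(v,v')=-A(v)U(v,v')$ with $U(v',v')=I$. *)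

theory Defs
  imports "HOL-Complex_Analysis.Complex_Analysis"
begin

definition annulus :: "real \<Rightarrow> complex set" where
  "annulus \<epsilon> = {z. 1 - \<epsilon> < cmod z \<and> cmod z < 1 + \<epsilon>}"

text \<open>Holomorphy in two variables: complex Frechet differentiability, i.e. the derivative is a
  complex-linear functional on \<open>\<complex> \<times> \<complex>\<close>.\<close>

definition holomorphic2_on :: "(complex \<Rightarrow> complex \<Rightarrow> complex) \<Rightarrow> (complex \<times> complex) set \<Rightarrow> bool" where
  "holomorphic2_on f S \<longleftrightarrow>
     (\<forall>p\<in>S. \<exists>\<alpha> \<beta>. ((\<lambda>q. f (fst q) (snd q)) has_derivative (\<lambda>h. \<alpha> * fst h + \<beta> * snd h)) (at p within S))"

definition cscale :: "complex \<Rightarrow> complex^'n^'m \<Rightarrow> complex^'n^'m" where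
  "cscale c A = (\<chi> i j. c * A $ i $ j)"

text \<open>\<open>C a b c v w\<close> stands for $\hat C^{abc}(v,w)$ and \<open>D a b z\<close> for $\hat D^{ab}(z)$. The flavors
  are the elements of the finite index type \<open>'n\<close>, so that $N$ is \<open>CARD('n)\<close>.\<close>

definition leibniz_rule ::
  "complex set \<Rightarrow> ('n::finite \<Rightarrow> 'n \<Rightarrow> 'n \<Rightarrow> complex \<Rightarrow> complex \<Rightarrow> complex) \<Rightarrow> ('n \<Rightarrow> 'n \<Rightarrow> complex \<Rightarrow> complex) \<Rightarrow> bool"
where
  "leibniz_rule S C D \<longleftrightarrow>
     (\<forall>a b c. \<forall>v\<in>S. \<forall>w\<in>S. v * w \<in> S \<longrightarrow>
        (\<Sum>d\<in>UNIV. C a b d v w * D d c (v * w)) =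
        (\<Sum>d\<in>UNIV. C d b c v w * D a d v) + (\<Sum>d\<in>UNIV. C a d c v w * D b d w))"

definition leibniz_system ::
  "real \<Rightarrow> ('n::finite \<Rightarrow> 'n \<Rightarrow> 'n \<Rightarrow> complex \<Rightarrow> complex \<Rightarrow> complex) \<Rightarrow> ('n \<Rightarrow> 'n \<Rightarrow> complex \<Rightarrow> complex) \<Rightarrow> bool"
where
  "leibniz_system \<epsilon> C D \<longleftrightarrow>
     (\<forall>a b c. holomorphic2_on (C a b c) (annulus \<epsilon> \<times> annulus \<epsilon>)) \<and>
     (\<forall>a b. D a b holomorphic_on annulus \<epsilon>) \<and>
     (\<forall>a b. D a b 1 = 0) \<and>
     leibniz_rule (annulus \<epsilon>) C D"

definition Mmat ::
  "('n::finite \<Rightarrow> 'n \<Rightarrow> 'n \<Rightarrow> complex \<Rightarrow> complex \<Rightarrow> complex) \<Rightarrow> 'n \<Rightarrow> complex \<Rightarrow> complex \<Rightarrow> complex^'n^'n" where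
  "Mmat C b v w = (\<chi> a c. C a b c v w)"

definition dMmat ::
  "('n::finite \<Rightarrow> 'n \<Rightarrow> 'n \<Rightarrow> complex \<Rightarrow> complex \<Rightarrow> complex) \<Rightarrow> 'n \<Rightarrow> complex \<Rightarrow> complex^'n^'n" where
  "dMmat C b v = (\<chi> a c. deriv (\<lambda>w. C a b c v w) 1)"

definition Dmat :: "('n::finite \<Rightarrow> 'n \<Rightarrow> complex \<Rightarrow> complex) \<Rightarrow> complex \<Rightarrow> complex^'n^'n" where
  "Dmat D z = (\<chi> a b. D a b z)"

text \<open>\<open>Y\<close> is the transport along \<open>\<gamma>\<close> based at parameter \<open>t\<close> for the matrix-valued form $B(v)\,dv$.
  As \<open>\<gamma>\<close> is only piecewise smooth, the differential equation is required off a finite set of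
  parameters, together with continuity everywhere. Points of the path are named by their
  parameters, because \<open>\<gamma>\<close> may intersect itself and the transport depends on the path.\<close>

definition path_transport ::
  "(real \<Rightarrow> complex) \<Rightarrow> (complex \<Rightarrow> complex^'n^'n) \<Rightarrow> real \<Rightarrow> (real \<Rightarrow> complex^'n^'n) \<Rightarrow> bool"
where
  "path_transport \<gamma> B t Y \<longleftrightarrow>
     continuous_on {0..1} Y \<and>
     (\<forall>s\<in>{0..1}. invertible (Y s)) \<and>
     Y t = mat 1 \<and>
     (\<exists>S. finite S \<and> (\<forall>s\<in>{0..1} - S.
        (Y has_vector_derivative
           cscale (vector_derivative \<gamma> (at s within {0..1})) (B (\<gamma> s) ** Y s)) (at s within {0..1})))"

text \<open>\<open>path_ordered_exp \<gamma> B s t\<close> is $P\exp\int B(v'')\,dv''$ along \<open>\<gamma>\<close> from \<open>\<gamma> t\<close> to \<open>\<gamma> s\<close>.\<close>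

definition path_ordered_exp ::
  "(real \<Rightarrow> complex) \<Rightarrow> (complex \<Rightarrow> complex^'n^'n) \<Rightarrow> real \<Rightarrow> real \<Rightarrow> complex^'n^'n"
where
  "path_ordered_exp \<gamma> B s t = (THE P. \<exists>Y. path_transport \<gamma> B t Y \<and> Y s = P)"

definition connection ::
  "('n::finite \<Rightarrow> 'n \<Rightarrow> 'n \<Rightarrow> complex \<Rightarrow> complex \<Rightarrow> complex) \<Rightarrow> 'n \<Rightarrow> complex \<Rightarrow> complex^'n^'n" where
  "connection C b v = cscale (- (1 / v)) (matrix_inv (Mmat C b v 1) ** dMmat C b v)"

definition Umat ::
  "('n::finite \<Rightarrow> 'n \<Rightarrow> 'n \<Rightarrow> complex \<Rightarrow> complex \<Rightarrow> complex) \<Rightarrow> 'n \<Rightarrow> (real \<Rightarrow> complex) \<Rightarrow> real \<Rightarrow> real \<Rightarrow> complex^'n^'n"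
where
  "Umat C b \<gamma> s t = path_ordered_exp \<gamma> (connection C b) s t"

definition Xmat ::
  "('n::finite \<Rightarrow> 'n \<Rightarrow> 'n \<Rightarrow> complex \<Rightarrow> complex \<Rightarrow> complex) \<Rightarrow> ('n \<Rightarrow> 'n \<Rightarrow> complex \<Rightarrow> complex) \<Rightarrow> 'n \<Rightarrow> complex \<Rightarrow> complex^'n^'n"
where
  "Xmat C D b v =
     (\<Sum>d\<in>UNIV. cscale (deriv (D b d) 1) (matrix_inv (Mmat C b v 1) ** Mmat C d v 1))"

end

theory Submission
  imports Defs
begin

text \<open>
  At \<open>w = 1\<close> the Leibniz rule says that \<open>M\<^sup>b(v,1)\<close> commutes with \<open>D(v)\<close>, because \<open>D(1) = 0\<close>.
  Differentiating it in \<open>w\<close> at \<open>w = 1\<close> and multiplying by the inverse of \<open>M\<^sup>b(v,1)\<close> therefore gives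
  \<open>v D'(v) = X(v) - [A(v), D(v)]\<close>. If \<open>W(t) = U(v, \<gamma> t)\<close>, the derivative of \<open>W D(\<gamma>) W\<^sup>-\<^sup>1\<close> along the path
  is \<open>(\<gamma>'/\<gamma>) W X(\<gamma>) W\<^sup>-\<^sup>1\<close>, and the integral formula is the fundamental theorem of calculus.
\<close>

text \<open>For fixed \<open>b\<close> the Leibniz rule is the matrix identity M^b(v,w) D(vw) = D(v)
  M^b(v,w) + sum over d of D^{bd}(w) M^d(v,w). The commutation at w = 1 is needed a second time
  after differentiating: it moves M^b(v,1)^{-1} past D(v), so that the two terms with the
  w-derivative of M^b form a commutator with A, which conjugation by U absorbs. The analytic work
  lies in U. It is given by a definite description, so transport along the path must be shown to
  exist and to be unique before anything can be said about it. Existence is obtained from a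
  connection that is holomorphic on an open set around the path; this calls for holomorphy in v of
  the inverse of M^b(v,1) and of the w-derivative of M^b, while the hypothesis speaks only of
  first-order differentiability in two variables. Uniqueness comes from a solution W of the dual
  equation with W Y = I. If both are I at the end of the path, then U(v, \<gamma> t) is W t and its
  inverse is Y t, so the antiderivative W D(\<gamma>) Y is differentiated by the product rule
  alone.\<close>

no_notation fps_nth (infixl "$" 75)

section \<open>Complex matrices\<close>

lemma cscale_nth [simp]: "cscale c A $ i $ j = c * A $ i $ j"
  by (simp add: cscale_def)

lemma cscale_mult_left: "cscale c A ** B = cscale c (A ** B)"
  by (simp add: vec_eq_iff matrix_matrix_mult_def sum_distrib_left mult.assoc)

lemma cscale_mult_right: "A ** cscale c B = cscale c (A ** B)"
  by (simp add: vec_eq_iff matrix_matrix_mult_def sum_distrib_left mult.left_commute)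

lemma cscale_add: "cscale c (A + B) = cscale c A + cscale c B"
  by (simp add: vec_eq_iff distrib_left)

lemma cscale_uminus: "cscale c (- A) = - cscale c A"
  by (simp add: vec_eq_iff)

lemma cscale_cscale: "cscale c (cscale d A) = cscale (c * d) A"
  by (simp add: vec_eq_iff)

lemma transpose_cscale: "transpose (cscale c A) = cscale c (transpose A)"
  by (simp add: vec_eq_iff transpose_def)

lemma matrix_mult_minus_left: "(- A) ** B = - (A ** B)" for A :: "complex^'n^'m"
  by (simp add: vec_eq_iff matrix_matrix_mult_def sum_negf)

lemma matrix_mult_minus_right: "A ** (- B) = - (A ** B)" for A :: "complex^'n^'m"
  by (simp add: vec_eq_iff matrix_matrix_mult_def sum_negf)

lemma transpose_uminus: "transpose (- A) = - transpose A" for A :: "complex^'n^'m"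
  by (simp add: vec_eq_iff transpose_def)

text \<open>Source of the product rule, of continuity of products and of distributivity over sums
  for \<open>**\<close>.\<close>

lemma bounded_bilinear_matrix_mult:
  "bounded_bilinear ((**) :: complex^'n^'m \<Rightarrow> complex^'k^'n \<Rightarrow> complex^'k^'m)"
  unfolding bilinear_conv_bounded_bilinear [symmetric] bilinear_def
  by (auto intro!: linearI simp: vec_eq_iff matrix_matrix_mult_def sum.distrib algebra_simps
      scaleR_sum_right)

lemma bounded_linear_transpose: "bounded_linear (transpose :: complex^'n^'m \<Rightarrow> complex^'m^'n)"
  unfolding linear_conv_bounded_linear [symmetric]
  by (auto intro!: linearI simp: vec_eq_iff transpose_def)

section \<open>Matrix inverses and entrywise regularity\<close>

lemma matrix_inv_inverse:
  fixes A :: "'a::field^'n^'n"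
  assumes "invertible A"
  shows "A ** matrix_inv A = mat 1" "matrix_inv A ** A = mat 1"
  using someI_ex [OF assms [unfolded invertible_def]] by (auto simp: matrix_inv_def)

lemma invertible_matrix_inv:
  fixes A :: "'a::field^'n^'n"
  assumes "invertible A"
  shows "invertible (matrix_inv A)"
  using matrix_inv_inverse [OF assms] unfolding invertible_def by blast

lemma matrix_inv_unique:
  fixes A :: "'a::field^'n^'n"
  assumes "A ** B = mat 1"
  shows "matrix_inv A = B"
proof -
  have "invertible A"
    using assms matrix_left_right_inverse invertible_def by blast
  then show ?thesis
    by (metis assms matrix_inv_inverse(2) matrix_mul_assoc matrix_mul_lid matrix_mul_rid)
qed

text \<open>Column \<open>j\<close> of the inverse solves A x = e_j, so Cramer's rule applies. Each
  entry becomes a quotient of determinants, which makes inversion preserve holomorphy.\<close>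

lemma matrix_inv_entry:
  fixes A :: "'a::field^'n^'n"
  assumes "invertible A"
  shows "matrix_inv A $ i $ j =
    det (\<chi> k l. if l = i then axis j 1 $ k else A $ k $ l) / det A"
proof -
  have "A *v (matrix_inv A *v axis j 1) = axis j 1"
    by (simp add: matrix_vector_mul_assoc matrix_inv_inverse assms)
  then have "matrix_inv A *v axis j 1 = 
      (\<chi> i. det (\<chi> k l. if l = i then axis j 1 $ k else A $ k $ l) / det A)"
    using cramer assms invertible_det_nz by blast
  moreover have "(matrix_inv A *v axis j 1) $ i = matrix_inv A $ i $ j"
    by (simp add: matrix_vector_mult_def axis_def if_distrib cong: if_cong)
  ultimately show ?thesis by simp
qed

lemma holomorphic_on_det:
  assumes "\<And>i j. (\<lambda>z. A z $ i $ j) holomorphic_on S"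
  shows "(\<lambda>z. det (A z :: complex^'n^'n)) holomorphic_on S"
  unfolding det_def by (intro holomorphic_intros assms)

lemma holomorphic_on_matrix_mult:
  assumes "\<And>i j. (\<lambda>z. A z $ i $ j) holomorphic_on S"
    and "\<And>i j. (\<lambda>z. B z $ i $ j) holomorphic_on S"
  shows "(\<lambda>z. (A z ** B z) $ i $ j) holomorphic_on S"
  unfolding matrix_matrix_mult_def by (auto intro!: holomorphic_intros assms)

lemma holomorphic_on_matrix_inv:
  assumes "\<And>i j. (\<lambda>z. A z $ i $ j) holomorphic_on S"
    and inv: "\<And>z. z \<in> S \<Longrightarrow> invertible (A z :: complex^'n^'n)"
  shows "(\<lambda>z. matrix_inv (A z) $ i $ j) holomorphic_on S"
proof -
  have "(\<lambda>z. (\<chi> k l. if l = i then axis j 1 $ k else A z $ k $ l) $ k $ l) holomorphic_on S" for k l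
    using assms(1) by (cases "l = i") auto
  then have "(\<lambda>z. det (\<chi> k l. if l = i then axis j 1 $ k else A z $ k $ l) / det (A z))
      holomorphic_on S"
    using inv assms(1) 
    by (intro holomorphic_on_divide holomorphic_on_det) (auto simp: invertible_det_nz)
  then show ?thesis
    using inv by (simp add: matrix_inv_entry cong: holomorphic_cong)
qed

lemma has_vector_derivative_vecI:
  fixes f :: "real \<Rightarrow> 'a::real_normed_vector^'n"
  assumes "\<And>i. ((\<lambda>x. f x $ i) has_vector_derivative f' $ i) F"
  shows "(f has_vector_derivative f') F"
  using assms unfolding has_vector_derivative_def has_derivative_def
  by (auto intro!: vec_tendstoI bounded_linear_scaleR_left)

lemma continuous_on_matrixI:
  assumes "\<And>i j. continuous_on S (\<lambda>x. A x $ i $ j)"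
  shows "continuous_on S A"
proof -
  have "continuous_on S (\<lambda>x. \<chi> i j. A x $ i $ j)"
    by (intro continuous_intros assms)
  then show ?thesis by simp
qed

section \<open>Holomorphic linear differential equations\<close>

text \<open>Taylor coefficients of the solution of \<Phi>' = B \<Phi> with \<Phi> = I at the centre,
  when \<open>B k\<close> are those of the coefficient matrix: compare the coefficients of the n-th
  power on both sides.\<close>

fun ode_coeff :: "(nat \<Rightarrow> complex^'n^'n) \<Rightarrow> nat \<Rightarrow> complex^'n^'n" where
  "ode_coeff B 0 = mat 1"
| "ode_coeff B (Suc n) = cscale (1 / of_nat (Suc n)) (\<Sum>k\<le>n. B k ** ode_coeff B (n - k))"

text \<open>The majorant: since \<open>1/R \<le> L\<close>, each of the \<open>n + 1\<close> terms of the recursion is at most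
  \<open>N K L\<^sup>n \<le> L\<^sup>n\<^sup>+\<^sup>1\<close>, and the prefactor is \<open>1/(n+1)\<close>.\<close>

lemma ode_coeff_bound:
  fixes B :: "nat \<Rightarrow> complex^'n^'n" and K L M :: real
  assumes B: "\<And>k i j. cmod (B k $ i $ j) \<le> K * M ^ k"
    and "0 \<le> M" "M \<le> L" "real CARD('n) * K \<le> L"
  shows "cmod (ode_coeff B n $ i $ j) \<le> L ^ n"
proof (induction n arbitrary: i j rule: less_induct)
  case (less n)
  have "0 \<le> L" using assms by simp
  have "0 \<le> K" using order_trans [OF norm_ge_zero B [of 0]] by simp
  show ?case
  proof (cases n)
    case 0
    then show ?thesis by (simp add: mat_def)
  next
    case (Suc m)
    have *: "cmod ((B k ** ode_coeff B (m - k)) $ i $ j) \<le> L ^ Suc m" if "k \<le> m" for k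
    proof -
      have "cmod ((B k ** ode_coeff B (m - k)) $ i $ j)
          \<le> (\<Sum>l\<in>UNIV. cmod (B k $ i $ l * ode_coeff B (m - k) $ l $ j))"
        by (simp add: matrix_matrix_mult_def sum_norm_le)
      also have "\<dots> \<le> (\<Sum>l\<in>(UNIV::'n set). (K * L ^ k) * L ^ (m - k))"
      proof (intro sum_mono)
        fix l
        have "K * M ^ k \<le> K * L ^ k"
          using assms \<open>0 \<le> K\<close> by (intro mult_left_mono power_mono) auto
        then show "cmod (B k $ i $ l * ode_coeff B (m - k) $ l $ j) \<le> (K * L ^ k) * L ^ (m - k)"
          unfolding norm_mult using less.IH [of "m - k" l j] B [of k i l] \<open>0 \<le> L\<close> \<open>0 \<le> K\<close> Suc
          by (intro mult_mono) auto
      qed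
      also have "\<dots> = (real CARD('n) * K) * L ^ m"
        using that by (simp add: power_add [symmetric])
      also have "\<dots> \<le> L * L ^ m"
        using assms \<open>0 \<le> L\<close> by (intro mult_right_mono) auto
      finally show ?thesis by simp
    qed
    have "cmod (ode_coeff B n $ i $ j)
        = cmod (\<Sum>k\<le>m. (B k ** ode_coeff B (m - k)) $ i $ j) / (m + 1)"
      using Suc by (simp add: norm_mult norm_divide del: of_nat_Suc)
    also have "\<dots> \<le> (\<Sum>k\<le>m. L ^ Suc m) / (m + 1)"
      by (intro divide_right_mono sum_norm_le) (auto simp: * simp del: power_Suc)
    also have "\<dots> = L ^ n"
      using Suc by (simp add: field_simps)
    finally show ?thesis .
  qed
qed

lemma fps_conv_radius_ge_inverse:
  fixes f :: "complex fps"
  assumes "\<And>n. cmod (fps_nth f n) \<le> L ^ n" "0 < L"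
  shows "fps_conv_radius f \<ge> ereal (1 / L)"
  unfolding fps_conv_radius_def
proof (rule conv_radius_geI_ex')
  fix r :: real assume r: "0 < r" "ereal r < ereal (1 / L)"
  have "summable (\<lambda>n. (L * r) ^ n)"
    using r assms by (intro summable_geometric) (auto simp: field_simps)
  then show "summable (\<lambda>n. fps_nth f n * of_real r ^ n)"
  proof (rule summable_comparison_test')
    fix n
    show "norm (fps_nth f n * of_real r ^ n) \<le> (L * r) ^ n"
      using r assms by (auto simp: norm_mult norm_power power_mult_distrib intro!: mult_right_mono)
  qed
qed

lemma eval_fps_sum:
  fixes f :: "'b \<Rightarrow> complex fps"
  assumes "\<And>i. i \<in> I \<Longrightarrow> ereal (norm z) < fps_conv_radius (f i)"
  shows "eval_fps (\<Sum>i\<in>I. f i) z = (\<Sum>i\<in>I. eval_fps (f i) z)"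
proof (cases "finite I")
  case True
  \<comment> \<open>The radius of the partial sum is carried through the induction because
    \<open>eval_fps_add\<close> asks for convergence of both summands. For infinite \<open>I\<close>
    both sums are 0 by convention.\<close>
  then have "eval_fps (\<Sum>i\<in>I. f i) z = (\<Sum>i\<in>I. eval_fps (f i) z) \<and>
      ereal (norm z) < fps_conv_radius (\<Sum>i\<in>I. f i)"
    using assms
  proof (induction I)
    case (insert i I)
    then show ?case
      using less_le_trans [OF _ fps_conv_radius_add] by (auto simp: eval_fps_add)
  qed auto
  then show ?thesis ..
qed auto

text \<open>Power series method: Cauchy's inequality bounds the coefficients of \<open>B\<close>
  geometrically, the majorant makes the formal solution converge, and its recursion is the
  differential equation read entry by entry.\<close>

lemma holomorphic_ode_local:
  fixes B :: "complex \<Rightarrow> complex^'n^'n"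
  assumes "open T" "z0 \<in> T" and hol: "\<And>i j. (\<lambda>z. B z $ i $ j) holomorphic_on T"
  shows "\<exists>r>0. \<exists>\<Phi> :: complex \<Rightarrow> complex^'n^'n. ball z0 r \<subseteq> T \<and>
    (\<forall>z\<in>ball z0 r. invertible (\<Phi> z) \<and>
      (\<forall>i j. ((\<lambda>z. \<Phi> z $ i $ j) has_field_derivative (B z ** \<Phi> z) $ i $ j) (at z)))"
proof -
  obtain R where R: "R > 0" "cball z0 R \<subseteq> T"
    using assms open_contains_cball by blast
  have holb: "(\<lambda>z. B z $ i $ j) holomorphic_on ball z0 R" for i j
    using hol R ball_subset_cball by (meson holomorphic_on_subset order_trans)
  have contb: "continuous_on (cball z0 R) (\<lambda>z. B z $ i $ j)" for i j
    using hol R by (meson holomorphic_on_subset holomorphic_on_imp_continuous_on)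
  have "\<exists>K. \<forall>z\<in>cball z0 R. cmod (B z $ i $ j) \<le> K" for i j
    using compact_continuous_image [OF contb compact_cball, THEN compact_imp_bounded]
    by (force simp: bounded_iff)
  then obtain Kf where Kf: "\<And>i j z. z \<in> cball z0 R \<Longrightarrow> cmod (B z $ i $ j) \<le> Kf i j"
    by metis
  \<comment> \<open>One constant that dominates the bounds of all entries at once.\<close>
  define K where "K = (\<Sum>i\<in>UNIV. \<Sum>j\<in>UNIV. \<bar>Kf i j\<bar> :: real)"
  have KfK: "Kf i j \<le> K" for i j
  proof -
    have "Kf i j \<le> \<bar>Kf i j\<bar>" by simp
    also have "\<dots> \<le> (\<Sum>j\<in>UNIV. \<bar>Kf i j\<bar>)" by (intro member_le_sum) auto
    also have "\<dots> \<le> K" unfolding K_def by (intro member_le_sum) (auto intro: sum_nonneg)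
    finally show ?thesis .
  qed
  define b where "b i j = fps_expansion (\<lambda>z. B z $ i $ j) z0" for i j
  have b_bound: "cmod (fps_nth (b i j) k) \<le> K * (1 / R) ^ k" for i j k
  proof -
    have "cmod ((deriv ^^ k) (\<lambda>z. B z $ i $ j) z0) \<le> fact k * K / R ^ k"
    proof (rule Cauchy_inequality [OF holb contb \<open>R > 0\<close>])
      show "cmod (B x $ i $ j) \<le> K" if "cmod (z0 - x) = R" for x
        using Kf [of x i j] KfK [of i j] that by (auto simp: dist_norm)
    qed
    then show ?thesis
      by (simp add: b_def fps_expansion_def norm_divide field_simps power_divide)
  qed
  have b_holo: "(\<lambda>z. B z $ i $ j) holomorphic_on eball z0 (ereal R)" for i j
    using holb by simp
  have b_conv: "fps_conv_radius (b i j) \<ge> ereal R" for i j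
    unfolding b_def by (rule conv_radius_fps_expansion [OF b_holo])
  have b_eval: "eval_fps (b i j) (z - z0) = B z $ i $ j" if "z \<in> ball z0 R" for i j z
    unfolding b_def using that by (intro eval_fps_expansion [OF b_holo]) auto
  define c where "c = ode_coeff (\<lambda>k. \<chi> i j. fps_nth (b i j) k)"
  \<comment> \<open>The least \<open>L\<close> that \<open>ode_coeff_bound\<close> admits for growth
    rate \<open>1 / R\<close>; it is positive because \<open>R\<close> is.\<close>
  define L where "L = max (1 / R) (real CARD('n) * K)"
  have L: "1 / R \<le> L" "real CARD('n) * K \<le> L" "0 < L"
    using R unfolding L_def by (auto simp: less_max_iff_disj)
  have c_bound: "cmod (c n $ i $ j) \<le> L ^ n" for n i j
    unfolding c_def using b_bound L R by (intro ode_coeff_bound [where K = K and M = "1 / R"]) auto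
  define f where "f i j = Abs_fps (\<lambda>n. c n $ i $ j)" for i j
  have f_conv: "fps_conv_radius (f i j) \<ge> ereal (1 / L)" for i j
    using c_bound L by (intro fps_conv_radius_ge_inverse) (auto simp: f_def)
  have f_deriv: "fps_deriv (f i j) = (\<Sum>l\<in>UNIV. b i l * f l j)" for i j
  proof (rule fps_ext)
    fix n
    have "fps_nth (fps_deriv (f i j)) n =
        (\<Sum>k\<le>n. \<Sum>l\<in>UNIV. fps_nth (b i l) k * c (n - k) $ l $ j)"
      by (simp add: f_def c_def matrix_matrix_mult_def del: of_nat_Suc)
    also have "\<dots> = fps_nth (\<Sum>l\<in>UNIV. b i l * f l j) n"
      by (subst sum.swap) (simp add: fps_sum_nth fps_mult_nth f_def atMost_atLeast0)
    finally show "fps_nth (fps_deriv (f i j)) n = fps_nth (\<Sum>l\<in>UNIV. b i l * f l j) n" .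
  qed
  define \<Phi> :: "complex \<Rightarrow> complex^'n^'n" where "\<Phi> z = (\<chi> i j. eval_fps (f i j) (z - z0))" for z
  define s where "s = min R (1 / L)"
  have s: "0 < s" "s \<le> R" "s \<le> 1 / L"
    using R L by (auto simp: s_def)
  have deriv: "((\<lambda>z. \<Phi> z $ i $ j) has_field_derivative (B z ** \<Phi> z) $ i $ j) (at z)"
    if z: "z \<in> ball z0 s" for z i j
  proof -
    have zs: "cmod (z - z0) < s" "z \<in> ball z0 R"
      using z s by (auto simp: dist_norm norm_minus_commute)
    have zf: "ereal (cmod (z - z0)) < fps_conv_radius (f i j)" for i j
      using zs s by (intro less_le_trans [OF _ f_conv]) auto
    have zb: "ereal (cmod (z - z0)) < fps_conv_radius (b i j)" for i j
      using zs s by (intro less_le_trans [OF _ b_conv]) auto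
    have "((\<lambda>z. eval_fps (f i j) (z - z0)) has_field_derivative
        eval_fps (fps_deriv (f i j)) (z - z0) * 1) (at z)"
      by (rule DERIV_chain2 [where f = "eval_fps (f i j)" and g = "\<lambda>z. z - z0", OF has_field_derivative_eval_fps [OF zf]])
        (auto intro!: derivative_eq_intros)
    also have "eval_fps (fps_deriv (f i j)) (z - z0) =
        (\<Sum>l\<in>UNIV. eval_fps (b i l * f l j) (z - z0))"
      unfolding f_deriv using zf zb
      by (intro eval_fps_sum less_le_trans [OF _ fps_conv_radius_mult]) auto
    also have "\<dots> = (B z ** \<Phi> z) $ i $ j"
      using zf zb zs by (simp add: eval_fps_mult matrix_matrix_mult_def \<Phi>_def b_eval)
    finally show ?thesis by (simp add: \<Phi>_def)
  qed
  \<comment> \<open>The determinant is continuous and equals 1 at the centre, so it has no zero on a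
    smaller ball; there \<Phi> is invertible.\<close>
  have "(\<lambda>z. det (\<Phi> z)) holomorphic_on ball z0 s"
    using deriv by (intro holomorphic_on_det) (meson holomorphic_on_open open_ball)
  then have cont: "continuous_on (ball z0 s) (\<lambda>z. det (\<Phi> z))"
    by (rule holomorphic_on_imp_continuous_on)
  have "\<Phi> z0 = mat 1"
    by (simp add: \<Phi>_def eval_fps_at_0 f_def c_def vec_eq_iff)
  then have "det (\<Phi> z0) \<noteq> 0" by simp
  obtain e where e: "e > 0" "ball z0 e \<subseteq> ball z0 s" "\<And>z. z \<in> ball z0 e \<Longrightarrow> det (\<Phi> z) \<noteq> 0"
  proof -
    have "open (ball z0 s \<inter> (\<lambda>z. det (\<Phi> z)) -` (- {0}))"
      by (intro continuous_open_preimage cont) auto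
    moreover have "z0 \<in> ball z0 s \<inter> (\<lambda>z. det (\<Phi> z)) -` (- {0})"
      using s \<open>det (\<Phi> z0) \<noteq> 0\<close> by auto
    ultimately obtain e where "e > 0" "ball z0 e \<subseteq> ball z0 s \<inter> (\<lambda>z. det (\<Phi> z)) -` (- {0})"
      using open_contains_ball by blast
    then show ?thesis using that by blast
  qed
  moreover have "ball z0 e \<subseteq> T"
    using e R s by (meson ball_subset_cball order_trans subset_ball)
  moreover have "invertible (\<Phi> z) \<and>
      (\<forall>i j. ((\<lambda>z. \<Phi> z $ i $ j) has_field_derivative (B z ** \<Phi> z) $ i $ j) (at z))"
    if "z \<in> ball z0 e" for z
    using e that deriv by (auto simp: invertible_det_nz)
  ultimately show ?thesis by blast
qed

section \<open>Transport along a path\<close>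

text \<open>Variant of \<open>path_transport\<close> suited to gluing: any parameter interval, no
  initial value, and two-sided derivatives, which the finite exceptional set allows to fail at the
  endpoints.\<close>

definition transport_on ::
  "(real \<Rightarrow> complex) \<Rightarrow> (complex \<Rightarrow> complex^'n^'n) \<Rightarrow> real \<Rightarrow> real \<Rightarrow> (real \<Rightarrow> complex^'n^'n) \<Rightarrow> bool"
where
  "transport_on \<gamma> B a b Y \<longleftrightarrow>
     continuous_on {a..b} Y \<and>
     (\<forall>s\<in>{a..b}. invertible (Y s)) \<and>
     (\<exists>S. finite S \<and> (\<forall>s\<in>{a..b} - S.
        (Y has_vector_derivative cscale (vector_derivative \<gamma> (at s)) (B (\<gamma> s) ** Y s)) (at s)))"

lemma finite_exceptions_cong:
  assumes "finite F" "\<And>s. s \<in> I - F \<Longrightarrow> P s \<longleftrightarrow> Q s"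
  shows "(\<exists>S. finite S \<and> (\<forall>s\<in>I - S. P s)) \<longleftrightarrow> (\<exists>S. finite S \<and> (\<forall>s\<in>I - S. Q s))"
proof (intro iffI; elim exE conjE)
  fix S assume "finite S" "\<forall>s\<in>I - S. P s"
  then show "\<exists>S. finite S \<and> (\<forall>s\<in>I - S. Q s)"
    using assms by (intro exI [of _ "S \<union> F"] conjI ballI) (simp, metis Diff_iff UnCI)
next
  fix S assume "finite S" "\<forall>s\<in>I - S. Q s"
  then show "\<exists>S. finite S \<and> (\<forall>s\<in>I - S. P s)"
    using assms by (intro exI [of _ "S \<union> F"] conjI ballI) (simp, metis Diff_iff UnCI)
qed

text \<open>One-sided and two-sided derivatives agree at interior parameters, and 0 and 1 can be
  added to the exceptional set.\<close>

lemma path_transport_iff: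
  "path_transport \<gamma> B t Y \<longleftrightarrow> transport_on \<gamma> B 0 1 Y \<and> Y t = mat 1"
proof -
  have "at s within {0..1} = at s" if "s \<in> {0..1} - {0, 1}" for s :: real
    using that by (auto intro!: at_within_Icc_at)
  then have "(\<exists>S. finite S \<and> (\<forall>s\<in>{0..1} - S.
        (Y has_vector_derivative
           cscale (vector_derivative \<gamma> (at s within {0..1})) (B (\<gamma> s) ** Y s)) (at s within {0..1})))
    \<longleftrightarrow> (\<exists>S. finite S \<and> (\<forall>s\<in>{0..1} - S.
        (Y has_vector_derivative cscale (vector_derivative \<gamma> (at s)) (B (\<gamma> s) ** Y s)) (at s)))"
    by (intro finite_exceptions_cong [where F = "{0, 1}"]) simp_all
  then show ?thesis
    unfolding path_transport_def transport_on_def by blast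
qed

lemma transport_on_cong:
  assumes "transport_on \<gamma> B a b Y"
    and "\<And>s. s \<in> {a..b} \<Longrightarrow> Y s = Z s" "\<And>s. s \<in> {a..b} \<Longrightarrow> B (\<gamma> s) = B' (\<gamma> s)"
  shows "transport_on \<gamma> B' a b Z"
proof -
  obtain S where S: "finite S" "\<And>s. s \<in> {a..b} - S \<Longrightarrow>
      (Y has_vector_derivative cscale (vector_derivative \<gamma> (at s)) (B (\<gamma> s) ** Y s)) (at s)"
    using assms(1) unfolding transport_on_def by blast
  have "(Z has_vector_derivative cscale (vector_derivative \<gamma> (at s)) (B' (\<gamma> s) ** Z s)) (at s)"
    \<comment> \<open>The endpoints become exceptional: agreement of \<open>Y\<close> and
      \<open>Z\<close> on the closed interval says nothing about two-sided derivatives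
      there.\<close>
    if "s \<in> {a..b} - (S \<union> {a, b})" for s
  proof -
    have "(Y has_vector_derivative cscale (vector_derivative \<gamma> (at s)) (B (\<gamma> s) ** Y s)) (at s)"
      using that by (intro S) auto
    then have "(Z has_vector_derivative cscale (vector_derivative \<gamma> (at s)) (B (\<gamma> s) ** Y s)) (at s)"
      by (rule has_vector_derivative_transform_within_open [where S = "{a<..<b}"])
        (use that assms(2) in auto)
    then show ?thesis
      using that assms(2,3) [of s] by simp
  qed
  then have "\<exists>S. finite S \<and> (\<forall>s\<in>{a..b} - S.
      (Z has_vector_derivative cscale (vector_derivative \<gamma> (at s)) (B' (\<gamma> s) ** Z s)) (at s))"
    using S(1) by (intro exI [of _ "S \<union> {a, b}"]) auto
  moreover have "continuous_on {a..b} Z \<longleftrightarrow> continuous_on {a..b} Y"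
    using assms(2) by (intro continuous_on_cong) auto
  ultimately show ?thesis
    using assms(1,2) unfolding transport_on_def by auto
qed

text \<open>The coefficient acts from the left, so constant right factors pass through the equation.
  This is what allows initial values to be prescribed.\<close>

lemma transport_on_mult_right:
  fixes P :: "complex^'n^'n"
  assumes "transport_on \<gamma> B a b Y" "invertible P"
  shows "transport_on \<gamma> B a b (\<lambda>s. Y s ** P)"
proof -
  have lin: "bounded_linear (\<lambda>A :: complex^'n^'n. A ** P)"
    by (rule bounded_bilinear.bounded_linear_left [OF bounded_bilinear_matrix_mult])
  have "((\<lambda>s. Y s ** P) has_vector_derivative
      cscale (vector_derivative \<gamma> (at s)) (B (\<gamma> s) ** (Y s ** P))) (at s)"
    if "(Y has_vector_derivative cscale (vector_derivative \<gamma> (at s)) (B (\<gamma> s) ** Y s)) (at s)" for s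
    using bounded_linear.has_vector_derivative [OF lin that]
    by (simp add: cscale_mult_left matrix_mul_assoc)
  moreover have "continuous_on {a..b} (\<lambda>s. Y s ** P)"
    using assms(1) bounded_linear.continuous_on [OF lin, of "{a..b}" Y]
    unfolding transport_on_def by blast
  ultimately show ?thesis
    using assms unfolding transport_on_def by (meson invertible_mult)
qed

lemma transport_on_glue:
  assumes Y: "transport_on \<gamma> B a b Y" and Z: "transport_on \<gamma> B b c Z" and "a \<le> b" "b \<le> c"
  obtains X where "transport_on \<gamma> B a c X"
proof -
  \<comment> \<open>Chosen so that \<open>Z b ** P = Y b\<close>: the rescaled second piece
    continues the first. Differentiability may fail at the joint, which becomes exceptional.\<close>
  define P where "P = matrix_inv (Z b) ** Y b"
  have inv: "invertible (Z b)" "invertible (Y b)"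
    using assms unfolding transport_on_def by auto
  then have "invertible P"
    by (simp add: P_def invertible_mult invertible_matrix_inv)
  define Z' where "Z' s = Z s ** P" for s
  have Z': "transport_on \<gamma> B b c Z'"
    unfolding Z'_def by (rule transport_on_mult_right [OF Z \<open>invertible P\<close>])
  have eq: "Z' b = Y b"
    by (simp add: Z'_def P_def matrix_mul_assoc matrix_inv_inverse inv)
  define X where "X s = (if s \<le> b then Y s else Z' s)" for s
  obtain S1 where S1: "finite S1" "\<And>s. s \<in> {a..b} - S1 \<Longrightarrow>
      (Y has_vector_derivative cscale (vector_derivative \<gamma> (at s)) (B (\<gamma> s) ** Y s)) (at s)"
    using Y unfolding transport_on_def by blast
  obtain S2 where S2: "finite S2" "\<And>s. s \<in> {b..c} - S2 \<Longrightarrow>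
      (Z' has_vector_derivative cscale (vector_derivative \<gamma> (at s)) (B (\<gamma> s) ** Z' s)) (at s)"
    using Z' unfolding transport_on_def by blast
  have "(X has_vector_derivative cscale (vector_derivative \<gamma> (at s)) (B (\<gamma> s) ** X s)) (at s)"
    if s: "s \<in> {a..c} - (S1 \<union> S2 \<union> {b})" for s
  proof (cases "s < b")
    case True
    then have "(Y has_vector_derivative cscale (vector_derivative \<gamma> (at s)) (B (\<gamma> s) ** X s)) (at s)"
      using S1(2) [of s] s by (simp add: X_def)
    then show ?thesis
      by (rule has_vector_derivative_transform_within_open [where S = "{..<b}"])
        (use True in \<open>auto simp: X_def\<close>)
  next
    case False
    then have "(Z' has_vector_derivative cscale (vector_derivative \<gamma> (at s)) (B (\<gamma> s) ** X s)) (at s)"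
      using S2(2) [of s] s by (simp add: X_def)
    then show ?thesis
      by (rule has_vector_derivative_transform_within_open [where S = "{b<..}"])
        (use False s in \<open>auto simp: X_def\<close>)
  qed
  moreover have "continuous_on ({a..b} \<union> {b..c}) X"
    unfolding X_def using Y Z' eq
    by (intro continuous_on_If) (auto simp: transport_on_def)
  then have "continuous_on {a..c} X"
    using assms(3,4) by (simp add: ivl_disj_un_two_touch)
  moreover have "invertible (X s)" if "s \<in> {a..c}" for s
    using that Y Z' by (auto simp: transport_on_def X_def)
  ultimately have "transport_on \<gamma> B a c X"
    unfolding transport_on_def using S1(1) S2(1)
    by (intro conjI ballI exI [of _ "S1 \<union> S2 \<union> {b}"]) auto
  then show ?thesis by (rule that)
qed

text \<open>The speed of a piecewise \<open>C\<^sup>1\<close> path may be unbounded near the exceptional parameters, so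
  transport is not obtained from the real equation along the path, but by composing the path with
  local holomorphic solutions.\<close>

lemma transport_on_exists:
  fixes B :: "complex \<Rightarrow> complex^'n^'n"
  assumes "valid_path \<gamma>" "open T" "path_image \<gamma> \<subseteq> T"
    and hol: "\<And>i j. (\<lambda>z. B z $ i $ j) holomorphic_on T"
  obtains Y where "transport_on \<gamma> B 0 1 Y"
proof -
  obtain S where S: "finite S" "\<And>s. s \<in> {0..1} - S \<Longrightarrow> \<gamma> differentiable (at s)"
    and cont: "continuous_on {0..1} \<gamma>"
    using assms(1) unfolding valid_path_def piecewise_C1_differentiable_on_def
      C1_differentiable_on_eq by blast
  have \<gamma>': "(\<gamma> has_vector_derivative vector_derivative \<gamma> (at s)) (at s)" if "s \<in> {0..1} - S" for s
    using S(2) [OF that] vector_derivative_works by blast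
  \<comment> \<open>Bisection: the property passes to adjacent intervals by gluing and holds for all
    short intervals around each parameter. The guard makes it vacuous for short intervals that stick
    out of the unit interval.\<close>
  let ?P = "\<lambda>a b. 0 \<le> a \<and> b \<le> 1 \<longrightarrow> (\<exists>Y. transport_on \<gamma> B a b Y)"
  have "?P 0 1"
  proof (rule Bolzano [of 0 1 ?P])
    show "0 \<le> (1::real)" by simp
  next
    fix a b c :: real
    assume "0 \<le> a \<and> b \<le> 1 \<longrightarrow> (\<exists>Y. transport_on \<gamma> B a b Y)"
      "0 \<le> b \<and> c \<le> 1 \<longrightarrow> (\<exists>Y. transport_on \<gamma> B b c Y)" "a \<le> b" "b \<le> c"
    moreover have "\<exists>X. transport_on \<gamma> B a c X"
      if "transport_on \<gamma> B a b Y" "transport_on \<gamma> B b c Z" for Y Z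
      using transport_on_glue [OF that \<open>a \<le> b\<close> \<open>b \<le> c\<close>] by blast
    ultimately show "0 \<le> a \<and> c \<le> 1 \<longrightarrow> (\<exists>Y. transport_on \<gamma> B a c Y)"
      using order_trans [of 0 a b] order_trans [of b c 1] by blast
  next
    fix x :: real assume "0 \<le> x" "x \<le> 1"
    then have x: "x \<in> {0..1}" by simp
    then have "\<gamma> x \<in> T" using assms(3) by (auto simp: path_image_def)
    obtain r and \<Phi> :: "complex \<Rightarrow> complex^'n^'n" where r: "r > 0" and
      local: "\<forall>z\<in>ball (\<gamma> x) r. invertible (\<Phi> z) \<and>
        (\<forall>i j. ((\<lambda>z. \<Phi> z $ i $ j) has_field_derivative (B z ** \<Phi> z) $ i $ j) (at z))"
      using holomorphic_ode_local [OF \<open>open T\<close> \<open>\<gamma> x \<in> T\<close> hol] by (elim exE conjE) (rule that)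
    have \<Phi>: "((\<lambda>z. \<Phi> z $ i $ j) has_field_derivative (B z ** \<Phi> z) $ i $ j) (at z)"
      if "z \<in> ball (\<gamma> x) r" for z i j
      using local that by simp
    obtain d where d: "d > 0" "\<And>s. s \<in> {0..1} \<Longrightarrow> dist s x < d \<Longrightarrow> dist (\<gamma> s) (\<gamma> x) < r"
      using cont x r unfolding continuous_on_iff by blast
    have "transport_on \<gamma> B a b (\<Phi> \<circ> \<gamma>)"
      if ab: "a \<le> x" "x \<le> b" "b - a < d" "0 \<le> a" "b \<le> 1" for a b
    proof -
      have in_ball: "\<gamma> s \<in> ball (\<gamma> x) r" if "s \<in> {a..b}" for s
      proof -
        have "s \<in> {0..1}" "\<bar>s - x\<bar> < d" using that ab by auto
        then show ?thesis using d(2) [of s] by (simp add: dist_commute dist_real_def)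
      qed
      have deriv: "((\<Phi> \<circ> \<gamma>) has_vector_derivative
          cscale (vector_derivative \<gamma> (at s)) (B (\<gamma> s) ** (\<Phi> \<circ> \<gamma>) s)) (at s)"
        if s: "s \<in> {a..b} - S" for s
      proof (intro has_vector_derivative_vecI)
        fix i j
        have *: "s \<in> {0..1} - S" "\<gamma> s \<in> ball (\<gamma> x) r"
          using s ab in_ball [of s] by auto
        show "((\<lambda>s. (\<Phi> \<circ> \<gamma>) s $ i $ j) has_vector_derivative
            cscale (vector_derivative \<gamma> (at s)) (B (\<gamma> s) ** (\<Phi> \<circ> \<gamma>) s) $ i $ j) (at s)"
          using field_vector_diff_chain_at [where g = "\<lambda>z. \<Phi> z $ i $ j", OF \<gamma>' [OF *(1)] \<Phi> [OF *(2)]]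
          by (simp add: o_def)
      qed
      have "continuous_on (ball (\<gamma> x) r) \<Phi>"
        by (intro continuous_on_matrixI continuous_at_imp_continuous_on ballI DERIV_isCont [OF \<Phi>])
      moreover have "continuous_on {a..b} \<gamma>"
        using ab by (intro continuous_on_subset [OF cont]) auto
      moreover have "\<gamma> ` {a..b} \<subseteq> ball (\<gamma> x) r"
        using in_ball by blast
      ultimately have cont': "continuous_on {a..b} (\<Phi> \<circ> \<gamma>)"
        unfolding o_def by (rule continuous_on_compose2)
      have "invertible ((\<Phi> \<circ> \<gamma>) s)" if "s \<in> {a..b}" for s
        using local in_ball [OF that] by simp
      then show ?thesis
        unfolding transport_on_def using S(1) cont' deriv
        by (intro conjI ballI exI [of _ S]) simp_all
    qed
    with d(1) show "\<exists>d>0. \<forall>a b. a \<le> x \<and> x \<le> b \<and> b - a < d \<longrightarrow>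
        0 \<le> a \<and> b \<le> 1 \<longrightarrow> (\<exists>Y. transport_on \<gamma> B a b Y)"
      by blast
  qed
  then show ?thesis using that by auto
qed

section \<open>Uniqueness of transport and the path-ordered exponential\<close>

lemma zero_vector_derivative_imp_eq:
  fixes f :: "real \<Rightarrow> 'a::banach"
  assumes "finite S" "continuous_on {a..b} f"
    and "\<And>s. s \<in> {a..b} - S \<Longrightarrow> (f has_vector_derivative 0) (at s)"
    and "s \<in> {a..b}" "t \<in> {a..b}"
  shows "f s = f t"
proof -
  have *: "f u = f a" if "u \<in> {a..b}" for u
  proof -
    have "((\<lambda>_. 0) has_integral f u - f a) {a..u}"
      by (rule fundamental_theorem_of_calculus_strong [OF assms(1)])
        (use that assms(2,3) in \<open>auto intro: continuous_on_subset\<close>)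
    then show ?thesis
      by (simp add: has_integral_0_eq)
  qed
  show ?thesis using * [OF assms(4)] * [OF assms(5)] by simp
qed

text \<open>The dual equation, solved by the inverses of transports: pairing a solution of it with a
  transport gives uniqueness and avoids differentiating \<^const>\<open>matrix_inv\<close>.\<close>

definition cotransport_on ::
  "(real \<Rightarrow> complex) \<Rightarrow> (complex \<Rightarrow> complex^'n^'n) \<Rightarrow> real \<Rightarrow> real \<Rightarrow> (real \<Rightarrow> complex^'n^'n) \<Rightarrow> bool"
where
  "cotransport_on \<gamma> B a b W \<longleftrightarrow>
     continuous_on {a..b} W \<and>
     (\<exists>S. finite S \<and> (\<forall>s\<in>{a..b} - S.
        (W has_vector_derivative cscale (vector_derivative \<gamma> (at s)) (- (W s ** B (\<gamma> s)))) (at s)))"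

text \<open>By the product rule the derivative of W Y is \<gamma>' (- W B Y + W B Y) = 0 off a
  finite set, and the product is continuous.\<close>

lemma transport_cotransport_constant:
  assumes Y: "transport_on \<gamma> B a b Y" and W: "cotransport_on \<gamma> B a b W"
    and st: "s \<in> {a..b}" "t \<in> {a..b}"
  shows "W s ** Y s = W t ** Y t"
proof -
  obtain S1 where S1: "finite S1" "\<And>s. s \<in> {a..b} - S1 \<Longrightarrow>
      (Y has_vector_derivative cscale (vector_derivative \<gamma> (at s)) (B (\<gamma> s) ** Y s)) (at s)"
    using Y unfolding transport_on_def by blast
  obtain S2 where S2: "finite S2" "\<And>s. s \<in> {a..b} - S2 \<Longrightarrow>
      (W has_vector_derivative cscale (vector_derivative \<gamma> (at s)) (- (W s ** B (\<gamma> s)))) (at s)"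
    using W unfolding cotransport_on_def by blast
  have "((\<lambda>s. W s ** Y s) has_vector_derivative 0) (at s)" if "s \<in> {a..b} - (S1 \<union> S2)" for s
    using bounded_bilinear.has_vector_derivative [OF bounded_bilinear_matrix_mult S2(2) [of s] S1(2) [of s]] that
    by (simp add: cscale_mult_left cscale_mult_right cscale_uminus matrix_mult_minus_left
        matrix_mult_minus_right matrix_mul_assoc)
  moreover have "continuous_on {a..b} (\<lambda>s. W s ** Y s)"
    using Y W unfolding transport_on_def cotransport_on_def
    by (auto intro: bounded_bilinear.continuous_on [OF bounded_bilinear_matrix_mult])
  ultimately show ?thesis
    using S1(1) S2(1) st by (intro zero_vector_derivative_imp_eq [where S = "S1 \<union> S2"]) auto
qed

text \<open>Transposing a transport for the negative transpose of \<open>B\<close> solves the dual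
  equation, so one existence theorem yields both. Normalising both at parameter 1 makes the constant
  product the identity.\<close>

lemma transport_pair_exists:
  fixes B :: "complex \<Rightarrow> complex^'n^'n"
  assumes "valid_path \<gamma>" "open T" "path_image \<gamma> \<subseteq> T"
    and hol: "\<And>i j. (\<lambda>z. B z $ i $ j) holomorphic_on T"
  obtains Y W where "transport_on \<gamma> B 0 1 Y" "cotransport_on \<gamma> B 0 1 W"
    "\<And>s. s \<in> {0..1} \<Longrightarrow> W s ** Y s = mat 1" "Y 1 = mat 1" "W 1 = mat 1"
proof -
  obtain Y0 where Y0: "transport_on \<gamma> B 0 1 Y0"
    using transport_on_exists [OF assms] by blast
  have "(\<lambda>z. (- transpose (B z)) $ i $ j) holomorphic_on T" for i j
    using holomorphic_on_minus [OF hol] by (simp add: transpose_def)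
  then obtain V where V: "transport_on \<gamma> (\<lambda>z. - transpose (B z)) 0 1 V"
    using transport_on_exists [OF assms(1-3), of "\<lambda>z. - transpose (B z)"] by blast
  define Y where "Y s = Y0 s ** matrix_inv (Y0 1)" for s
  define V' where "V' s = V s ** matrix_inv (V 1)" for s
  define W where "W s = transpose (V' s)" for s
  have inv: "invertible (Y0 1)" "invertible (V 1)"
    using Y0 V unfolding transport_on_def by auto
  then have inv': "invertible (matrix_inv (Y0 1))" "invertible (matrix_inv (V 1))"
    by (simp_all add: invertible_matrix_inv)
  have Y: "transport_on \<gamma> B 0 1 Y"
    unfolding Y_def by (rule transport_on_mult_right [OF Y0 inv'(1)])
  have V': "transport_on \<gamma> (\<lambda>z. - transpose (B z)) 0 1 V'"
    unfolding V'_def by (rule transport_on_mult_right [OF V inv'(2)])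
  have "(W has_vector_derivative cscale (vector_derivative \<gamma> (at s)) (- (W s ** B (\<gamma> s)))) (at s)"
    if "(V' has_vector_derivative cscale (vector_derivative \<gamma> (at s)) (- transpose (B (\<gamma> s)) ** V' s)) (at s)"
    for s
    using bounded_linear.has_vector_derivative [OF bounded_linear_transpose that]
    unfolding W_def [abs_def]
    by (simp add: transpose_cscale matrix_mult_minus_left transpose_uminus matrix_transpose_mul)
  moreover have "continuous_on {0..1} W"
    using V' unfolding transport_on_def W_def [abs_def]
    by (auto intro: bounded_linear.continuous_on [OF bounded_linear_transpose])
  ultimately have W: "cotransport_on \<gamma> B 0 1 W"
    using V' unfolding transport_on_def cotransport_on_def by blast
  have 1: "Y 1 = mat 1" "W 1 = mat 1"
    by (simp_all add: Y_def W_def V'_def matrix_inv_inverse inv)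
  show ?thesis
  proof (rule that [OF Y W _ 1])
    show "W s ** Y s = mat 1" if "s \<in> {0..1}" for s
      using transport_cotransport_constant [OF Y W that, of 1] 1 by simp
  qed
qed

text \<open>For any transport \<open>Z\<close> based at \<open>t\<close>, the product W Z is
  constant with value \<open>W t\<close>; multiplying by \<open>Y s\<close>, the inverse of
  \<open>W s\<close>, leaves only one candidate.\<close>

lemma path_transport_from_pair:
  assumes Y: "transport_on \<gamma> B 0 1 Y" and W: "cotransport_on \<gamma> B 0 1 W"
    and WY: "\<And>s. s \<in> {0..1} \<Longrightarrow> W s ** Y s = mat 1"
    and t: "t \<in> {0..1}"
  shows "path_transport \<gamma> B t (\<lambda>s. Y s ** W t)"
    and "path_transport \<gamma> B t Z \<Longrightarrow> s \<in> {0..1} \<Longrightarrow> Z s = Y s ** W t"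
proof -
  have YW: "Y s ** W s = mat 1" if "s \<in> {0..1}" for s
    using WY [OF that] matrix_left_right_inverse by blast
  have "invertible (W t)"
    unfolding invertible_def using WY YW t by blast
  then show "path_transport \<gamma> B t (\<lambda>s. Y s ** W t)"
    unfolding path_transport_iff using transport_on_mult_right [OF Y] YW t by blast
  assume Z: "path_transport \<gamma> B t Z" and s: "s \<in> {0..1}"
  then have "W s ** Z s = W t"
    using transport_cotransport_constant [OF _ W s t, of Z] unfolding path_transport_iff by simp
  then show "Z s = Y s ** W t"
    by (metis YW s matrix_mul_assoc matrix_mul_lid)
qed

text \<open>Existence and uniqueness together give the definite description its value, the familiar
  Y(s) Y(t)^{-1}.\<close>

lemma path_ordered_exp_eq:
  assumes "transport_on \<gamma> B 0 1 Y" "cotransport_on \<gamma> B 0 1 W"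
    and "\<And>s. s \<in> {0..1} \<Longrightarrow> W s ** Y s = mat 1"
    and "s \<in> {0..1}" "t \<in> {0..1}"
  shows "path_ordered_exp \<gamma> B s t = Y s ** W t"
  unfolding path_ordered_exp_def
proof (rule the_equality)
  show "\<exists>Z. path_transport \<gamma> B t Z \<and> Z s = Y s ** W t"
    using path_transport_from_pair(1) [OF assms(1-3,5)] by blast
  show "P = Y s ** W t" if "\<exists>Z. path_transport \<gamma> B t Z \<and> Z s = P" for P
    using path_transport_from_pair(2) [OF assms(1-3,5) _ assms(4)] that by blast
qed

text \<open>The descriptions taken separately for each \<open>s\<close> all pick values of one and
  the same transport.\<close>

lemma path_transport_path_ordered_exp:
  assumes "transport_on \<gamma> B 0 1 Y" "cotransport_on \<gamma> B 0 1 W"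
    and "\<And>s. s \<in> {0..1} \<Longrightarrow> W s ** Y s = mat 1"
    and "t \<in> {0..1}"
  shows "path_transport \<gamma> B t (\<lambda>s. path_ordered_exp \<gamma> B s t)"
proof -
  have "Y s ** W t = path_ordered_exp \<gamma> B s t" if "s \<in> {0..1}" for s
    using path_ordered_exp_eq [of \<gamma> B Y W s t] assms that by simp
  then show ?thesis
    using path_transport_from_pair(1) [OF assms] assms(4)
    unfolding path_transport_iff using transport_on_cong [of \<gamma> B 0 1 "\<lambda>s. Y s ** W t"] by simp
qed

text \<open>Serves the determinacy claim, where two connections are known to agree only along the
  path.\<close>

lemma path_ordered_exp_cong:
  assumes "\<And>s. s \<in> {0..1} \<Longrightarrow> B (\<gamma> s) = B' (\<gamma> s)"
  shows "path_ordered_exp \<gamma> B s t = path_ordered_exp \<gamma> B' s t"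
proof -
  have "transport_on \<gamma> B 0 1 Y \<longleftrightarrow> transport_on \<gamma> B' 0 1 Y" for Y
    using transport_on_cong [of \<gamma> B 0 1 Y Y B'] transport_on_cong [of \<gamma> B' 0 1 Y Y B] assms by auto
  then show ?thesis
    by (simp add: path_ordered_exp_def path_transport_iff)
qed

section \<open>The Leibniz system\<close>

lemma open_annulus: "open (annulus \<epsilon>)"
proof -
  have "annulus \<epsilon> = cmod -` {1 - \<epsilon> <..< 1 + \<epsilon>}"
    by (auto simp: annulus_def)
  then show ?thesis
    by (simp add: open_vimage continuous_on_norm_id)
qed

lemma one_in_annulus: "0 < \<epsilon> \<Longrightarrow> 1 \<in> annulus \<epsilon>"
  by (simp add: annulus_def)

lemma zero_notin_annulus: "\<epsilon> < 1 \<Longrightarrow> 0 \<notin> annulus \<epsilon>"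
  by (simp add: annulus_def)

section \<open>Holomorphy in two variables and of a partial derivative\<close>

lemma holomorphic2_on_imp_continuous_on:
  assumes "holomorphic2_on f S"
  shows "continuous_on S (\<lambda>q. f (fst q) (snd q))"
  unfolding continuous_on_eq_continuous_within
proof
  fix p assume "p \<in> S"
  then obtain \<alpha> \<beta> where
    "((\<lambda>q. f (fst q) (snd q)) has_derivative (\<lambda>h. \<alpha> * fst h + \<beta> * snd h)) (at p within S)"
    using assms unfolding holomorphic2_on_def by metis
  then show "continuous (at p within S) (\<lambda>q. f (fst q) (snd q))"
    by (rule has_derivative_continuous)
qed

text \<open>Chain rule; the complex-linear form of the derivative keeps the composite complex
  differentiable. It is applied with one inner function constant, to obtain the slices in v and in
  w.\<close>

lemma holomorphic2_on_compose:
  assumes f: "holomorphic2_on f S" and g: "\<And>z. z \<in> A \<Longrightarrow> (g z, h z) \<in> S"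
    and "g holomorphic_on A" "h holomorphic_on A"
  shows "(\<lambda>z. f (g z) (h z)) holomorphic_on A"
  unfolding holomorphic_on_def
proof
  fix z assume z: "z \<in> A"
  obtain \<alpha> \<beta> where "((\<lambda>q. f (fst q) (snd q)) has_derivative (\<lambda>h. \<alpha> * fst h + \<beta> * snd h))
      (at (g z, h z) within S)"
    using f g [OF z] unfolding holomorphic2_on_def by metis
  then have f': "((\<lambda>q. f (fst q) (snd q)) has_derivative (\<lambda>h. \<alpha> * fst h + \<beta> * snd h))
      (at (g z, h z) within (\<lambda>z. (g z, h z)) ` A)"
    by (rule has_derivative_subset) (use g in auto)
  obtain g' h' where "(g has_field_derivative g') (at z within A)" 
    "(h has_field_derivative h') (at z within A)"
    using assms(3,4) z unfolding holomorphic_on_def field_differentiable_def by metis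
  then have "((\<lambda>z. (g z, h z)) has_derivative (\<lambda>u. (g' * u, h' * u))) (at z within A)"
    unfolding has_field_derivative_def by (rule has_derivative_Pair)
  from has_derivative_in_compose [OF this f']
  have "((\<lambda>z. f (g z) (h z)) has_derivative (\<lambda>u. (\<alpha> * g' + \<beta> * h') * u)) (at z within A)"
    by (simp add: algebra_simps)
  then show "(\<lambda>z. f (g z) (h z)) field_differentiable at z within A"
    unfolding field_differentiable_def has_field_derivative_def by blast
qed

text \<open>First-order Taylor estimate. A disc of radius \<open>r / 2\<close> around a point of the
  half-size ball stays in the large one, so Cauchy's inequality bounds the second derivative by 2! K
  / (r/2)^2 = 8 K / r^2. The function enters only through \<open>K\<close>, hence the bound is
  uniform over a family.\<close>

lemma difference_quotient_bound:
  assumes hol: "f holomorphic_on ball w r" and cont: "continuous_on (cball w r) f" and "0 < r"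
    and K: "\<And>z. z \<in> cball w r \<Longrightarrow> cmod (f z) \<le> K"
    and h: "h \<noteq> 0" "cmod h < r / 2"
  shows "cmod ((f (w + h) - f w) / h - deriv f w) \<le> 8 * K / r\<^sup>2 * cmod h"
proof -
  have "cmod ((deriv ^^ 2) f z) \<le> 8 * K / r\<^sup>2" if z: "z \<in> ball w (r / 2)" for z
  proof -
    have sub: "cball z (r / 2) \<subseteq> cball w r"
    proof
      fix x assume "x \<in> cball z (r / 2)"
      then show "x \<in> cball w r"
        using z dist_triangle [of w x z] by (simp add: dist_commute)
    qed
    have "cmod ((deriv ^^ 2) f z) \<le> fact 2 * K / (r / 2) ^ 2"
    proof (rule Cauchy_inequality)
      show "f holomorphic_on ball z (r / 2)"
        using hol
      proof (rule holomorphic_on_subset)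
        show "ball z (r / 2) \<subseteq> ball w r"
        proof
          fix x assume "x \<in> ball z (r / 2)"
          then show "x \<in> ball w r"
            using z dist_triangle [of w x z] by (simp add: dist_commute)
        qed
      qed
      show "continuous_on (cball z (r / 2)) f"
        using cont sub by (rule continuous_on_subset)
      show "cmod (f x) \<le> K" if "cmod (z - x) = r / 2" for x
        using sub that by (intro K) (auto simp: dist_norm)
    qed (use \<open>0 < r\<close> in auto)
    then show ?thesis by (simp add: power_divide)
  qed
  then have "cmod ((deriv ^^ 0) f (w + h) - (\<Sum>i\<le>1. (deriv ^^ i) f w * (w + h - w) ^ i / fact i))
      \<le> 8 * K / r\<^sup>2 * cmod (w + h - w) ^ Suc 1 / fact 1"
  proof (intro complex_Taylor [where S = "ball w (r / 2)"])
    fix i :: nat and x assume x: "x \<in> ball w (r / 2)"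
    have "((deriv ^^ i) f has_field_derivative deriv ((deriv ^^ i) f) x) (at x)"
      using hol x \<open>0 < r\<close>
      by (intro holomorphic_derivI [OF holomorphic_higher_deriv, of f "ball w r"]) auto
    then show "((deriv ^^ i) f has_field_derivative (deriv ^^ Suc i) f x) (at x within ball w (r / 2))"
      by (simp add: has_field_derivative_at_within)
  qed (use h \<open>0 < r\<close> in \<open>auto simp: dist_norm numeral_2_eq_2\<close>)
  then have "cmod (f (w + h) - f w - deriv f w * h) \<le> 8 * K / r\<^sup>2 * cmod h * cmod h"
    by (simp add: power2_eq_square diff_diff_eq mult.assoc)
  then have "cmod (f (w + h) - f w - deriv f w * h) / cmod h \<le> 8 * K / r\<^sup>2 * cmod h"
    using h by (simp add: pos_divide_le_eq)
  moreover have "(f (w + h) - f w) / h - deriv f w = (f (w + h) - f w - deriv f w * h) / h"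
    using h by (simp add: field_simps)
  ultimately show ?thesis by (simp add: norm_divide)
qed

text \<open>The difference quotients in the second variable are holomorphic in the first and
  converge locally uniformly; a locally uniform limit of holomorphic functions is
  holomorphic.\<close>

lemma holomorphic_on_deriv_snd:
  assumes f: "holomorphic2_on f (A \<times> B)" and "open A" "open B" "w \<in> B"
  shows "(\<lambda>v. deriv (f v) w) holomorphic_on A"
proof -
  obtain r where r: "r > 0" "cball w r \<subseteq> B"
    using assms open_contains_cball by blast
  \<comment> \<open>With + 2 the modulus is strictly below \<open>r / 2\<close> already for
    \<open>n = 0\<close>, as the difference quotient bound requires.\<close>
  define h where "h n = complex_of_real (r / 2 / (real n + 2))" for n
  have norm_h: "cmod (h n) = r / 2 / (real n + 2)" for n
    unfolding h_def norm_of_real using r(1) by simp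
  have h: "h n \<noteq> 0" "cmod (h n) < r / 2" for n
  proof -
    show "cmod (h n) < r / 2"
      unfolding norm_h using r(1) by (simp add: field_simps add_pos_nonneg)
    have "cmod (h n) \<noteq> 0"
      unfolding norm_h using r(1) by (simp add: add_nonneg_eq_0_iff)
    then show "h n \<noteq> 0" by auto
  qed
  have hB: "w + h n \<in> B" for n
  proof (rule subsetD [OF r(2)])
    show "w + h n \<in> cball w r"
      using h(2) [of n] r(1) by (simp add: dist_norm)
  qed
  have h0: "(\<lambda>n. cmod (h n)) \<longlonglongrightarrow> 0"
    unfolding norm_h using r(1) by real_asymp
  show ?thesis
  proof (rule holomorphic_uniform_sequence [OF \<open>open A\<close>])
    show "(\<lambda>v. (f v (w + h n) - f v w) / h n) holomorphic_on A" for n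
      using hB h(1) \<open>w \<in> B\<close>
      by (intro holomorphic_on_divide holomorphic_on_diff holomorphic_on_const
          holomorphic2_on_compose [OF f] holomorphic_on_ident) auto
    fix x assume "x \<in> A"
    then obtain d where d: "d > 0" "cball x d \<subseteq> A"
      using \<open>open A\<close> open_contains_cball by blast
    \<comment> \<open>Joint continuity on a compact product gives one bound \<open>K\<close> for all
      slices, which makes the convergence uniform in v.\<close>
    have "continuous_on (cball x d \<times> cball w r) (\<lambda>q. f (fst q) (snd q))"
      using holomorphic2_on_imp_continuous_on [OF f] by (rule continuous_on_subset) (use d r in auto)
    then have "bounded ((\<lambda>q. f (fst q) (snd q)) ` (cball x d \<times> cball w r))"
      by (intro compact_imp_bounded compact_continuous_image compact_Times compact_cball)
    then obtain K where "\<forall>v\<in>cball x d. \<forall>z\<in>cball w r. cmod (f v z) \<le> K"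
      unfolding bounded_iff by auto
    then have K: "cmod (f v z) \<le> K" if "v \<in> cball x d" "z \<in> cball w r" for v z
      using that by blast
    have "uniform_limit (cball x d) (\<lambda>n v. (f v (w + h n) - f v w) / h n) (\<lambda>v. deriv (f v) w)
        sequentially"
    proof (rule uniform_limitI)
      fix e :: real assume "e > 0"
      have "(\<lambda>n. 8 * K / r\<^sup>2 * cmod (h n)) \<longlonglongrightarrow> 8 * K / r\<^sup>2 * 0"
        by (intro tendsto_mult_left h0)
      then have "\<forall>\<^sub>F n in sequentially. 8 * K / r\<^sup>2 * cmod (h n) < e"
        using \<open>e > 0\<close> by (intro order_tendstoD(2) [where y = "8 * K / r\<^sup>2 * 0"]) auto
      then show "\<forall>\<^sub>F n in sequentially. \<forall>v\<in>cball x d.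
          dist ((f v (w + h n) - f v w) / h n) (deriv (f v) w) < e"
      proof (rule eventually_mono, intro ballI)
        fix n v assume n: "8 * K / r\<^sup>2 * cmod (h n) < e" and v: "v \<in> cball x d"
        have hol: "f v holomorphic_on B"
          using holomorphic2_on_compose [OF f, of B "\<lambda>_. v" "\<lambda>z. z"] v d(2) by auto
        have "cmod ((f v (w + h n) - f v w) / h n - deriv (f v) w) \<le> 8 * K / r\<^sup>2 * cmod (h n)"
        proof (rule difference_quotient_bound)
          show "f v holomorphic_on ball w r"
            using hol r(2) ball_subset_cball by (blast intro: holomorphic_on_subset)
          show "continuous_on (cball w r) (f v)"
            using holomorphic_on_imp_continuous_on [OF hol] r(2) by (rule continuous_on_subset)
        qed (use r(1) h K v in simp_all)
        then show "dist ((f v (w + h n) - f v w) / h n) (deriv (f v) w) < e"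
          using n by (simp add: dist_norm)
      qed
    qed
    then show "\<exists>d>0. cball x d \<subseteq> A \<and>
        uniform_limit (cball x d) (\<lambda>n v. (f v (w + h n) - f v w) / h n) (\<lambda>v. deriv (f v) w) sequentially"
      using d by blast
  qed
qed

section \<open>The differential equation for D\<close>

lemma leibniz_systemD:
  assumes "leibniz_system \<epsilon> C D" "v \<in> annulus \<epsilon>" "w \<in> annulus \<epsilon>" "v * w \<in> annulus \<epsilon>"
  shows "(\<Sum>d\<in>UNIV. C a b d v w * D d c (v * w)) =
    (\<Sum>d\<in>UNIV. C d b c v w * D a d v) + (\<Sum>d\<in>UNIV. C a d c v w * D b d w)"
proof -
  have "leibniz_rule (annulus \<epsilon>) C D"
    using assms(1) by (simp add: leibniz_system_def)
  then show ?thesis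
    using assms(2-4) unfolding leibniz_rule_def by (elim allE ballE impE) auto
qed

lemma leibniz_system_commute:
  assumes sys: "leibniz_system \<epsilon> C D" and "0 < \<epsilon>" "v \<in> annulus \<epsilon>"
  shows "Mmat C b v 1 ** Dmat D v = Dmat D v ** Mmat C b v 1"
proof -
  have "D a c 1 = 0" for a c
    using sys by (simp add: leibniz_system_def)
  then have "(\<Sum>d\<in>UNIV. C a b d v 1 * D d c v) = (\<Sum>d\<in>UNIV. C d b c v 1 * D a d v)" for a c
    using leibniz_systemD [OF sys, of v 1 a b c] assms one_in_annulus [of \<epsilon>] by simp
  then show ?thesis
    by (simp add: vec_eq_iff matrix_matrix_mult_def Mmat_def Dmat_def mult.commute)
qed

text \<open>The w-derivative of the rule at w = 1. The factor \<open>v\<close> is the inner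
  derivative of D(vw); in the last sum D(1) = 0 removes every term in which M^d is
  differentiated.\<close>

lemma leibniz_system_deriv:
  assumes sys: "leibniz_system \<epsilon> C D" and "0 < \<epsilon>" and v: "v \<in> annulus \<epsilon>"
  shows "dMmat C b v ** Dmat D v + cscale v (Mmat C b v 1 ** (\<chi> a c. deriv (D a c) v)) =
    Dmat D v ** dMmat C b v + (\<Sum>d\<in>UNIV. cscale (deriv (D b d) 1) (Mmat C d v 1))"
proof -
  have one: "1 \<in> annulus \<epsilon>" using assms one_in_annulus by blast
  have holD: "D a c holomorphic_on annulus \<epsilon>" for a c
    using sys by (simp add: leibniz_system_def)
  have D1: "D a c 1 = 0" for a c
    using sys by (simp add: leibniz_system_def)
  have "C a d c v holomorphic_on annulus \<epsilon>" for a d c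
    using holomorphic2_on_compose [of "C a d c" "annulus \<epsilon> \<times> annulus \<epsilon>" "annulus \<epsilon>" "\<lambda>_. v" "\<lambda>z. z"] sys v
    by (auto simp: leibniz_system_def)
  then have C': "(C a d c v has_field_derivative deriv (C a d c v) 1) (at 1)" for a d c
    by (rule holomorphic_derivI [OF _ open_annulus one])
  have D': "(D a c has_field_derivative deriv (D a c) z) (at z)" if "z \<in> annulus \<epsilon>" for a c z
    by (rule holomorphic_derivI [OF holD open_annulus that])
  have Dv': "((\<lambda>w. D a c (v * w)) has_field_derivative deriv (D a c) v * v) (at 1)" for a c
    by (rule DERIV_chain2 [where f = "D a c" and g = "\<lambda>w. v * w"])
      (use D' [OF v] in \<open>auto intro!: derivative_eq_intros\<close>)
  have "(\<Sum>d\<in>UNIV. deriv (C a b d v) 1 * D d c v) + v * (\<Sum>d\<in>UNIV. C a b d v 1 * deriv (D d c) v) =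
      (\<Sum>d\<in>UNIV. D a d v * deriv (C d b c v) 1) + (\<Sum>d\<in>UNIV. deriv (D b d) 1 * C a d c v 1)"
    for a c
  proof -
    have L: "((\<lambda>w. \<Sum>d\<in>UNIV. C a b d v w * D d c (v * w)) has_field_derivative
        (\<Sum>d\<in>UNIV. C a b d v 1 * (deriv (D d c) v * v) + deriv (C a b d v) 1 * D d c (v * 1))) (at 1)"
      by (intro DERIV_sum DERIV_mult' C' Dv')
    have R: "((\<lambda>w. (\<Sum>d\<in>UNIV. C d b c v w * D a d v) + (\<Sum>d\<in>UNIV. C a d c v w * D b d w))
        has_field_derivative (\<Sum>d\<in>UNIV. deriv (C d b c v) 1 * D a d v) +
          (\<Sum>d\<in>UNIV. C a d c v 1 * deriv (D b d) 1 + deriv (C a d c v) 1 * D b d 1)) (at 1)"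
      by (intro DERIV_add DERIV_sum DERIV_mult' DERIV_cmult_right C' D' one)
    \<comment> \<open>The rule holds only while \<open>w\<close> and \<open>v * w\<close> both stay
      in the annulus. This is an open condition met at w = 1, so the two sides agree near 1 and have
      the same derivative.\<close>
    have "open (annulus \<epsilon> \<inter> (\<lambda>w. v * w) -` annulus \<epsilon>)"
      by (intro open_Int open_vimage open_annulus continuous_intros)
    moreover have "1 \<in> annulus \<epsilon> \<inter> (\<lambda>w. v * w) -` annulus \<epsilon>"
      using one v by simp
    ultimately have "\<forall>\<^sub>F w in nhds 1. w \<in> annulus \<epsilon> \<inter> (\<lambda>w. v * w) -` annulus \<epsilon>"
      by (rule eventually_nhds_in_open)
    then have "\<forall>\<^sub>F w in nhds 1. (\<Sum>d\<in>UNIV. C a b d v w * D d c (v * w)) =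
        (\<Sum>d\<in>UNIV. C d b c v w * D a d v) + (\<Sum>d\<in>UNIV. C a d c v w * D b d w)"
      by eventually_elim (use leibniz_systemD [OF sys v] in blast)
    then have "((\<lambda>w. \<Sum>d\<in>UNIV. C a b d v w * D d c (v * w)) has_field_derivative
        (\<Sum>d\<in>UNIV. deriv (C d b c v) 1 * D a d v) +
          (\<Sum>d\<in>UNIV. C a d c v 1 * deriv (D b d) 1 + deriv (C a d c v) 1 * D b d 1)) (at 1)"
      by (rule DERIV_cong_ev [OF refl _ refl, THEN iffD2]) (rule R)
    from DERIV_unique [OF L this] show ?thesis
      by (simp add: D1 sum.distrib sum_distrib_left mult_ac add_ac)
  qed
  then show ?thesis
    by (simp add: vec_eq_iff matrix_matrix_mult_def Mmat_def Dmat_def dMmat_def)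
qed

text \<open>Multiply the differentiated rule by N = M^b(v,1)^{-1}, which commutes with D(v) because
  M^b(v,1) does. Since \<open>connection\<close> is -A/v, the last two terms are [A, D]/v.\<close>

lemma leibniz_system_ode:
  assumes sys: "leibniz_system \<epsilon> C D" and eps: "0 < \<epsilon>" "\<epsilon> < 1" and v: "v \<in> annulus \<epsilon>"
    and inv: "invertible (Mmat C b v 1)"
  shows "cscale (1 / v) (Xmat C D b v) =
    (\<chi> a c. deriv (D a c) v) - connection C b v ** Dmat D v + Dmat D v ** connection C b v"
proof -
  define M where "M = Mmat C b v 1"
  define N where "N = matrix_inv M"
  define E :: "complex^'a^'a" where "E = (\<chi> a c. deriv (D a c) v)"
  define T where "T = (\<Sum>d\<in>UNIV. cscale (deriv (D b d) 1) (Mmat C d v 1))"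
  have v0: "v \<noteq> 0" using v zero_notin_annulus [OF eps(2)] by blast
  have MN: "M ** N = mat 1" "N ** M = mat 1"
    using matrix_inv_inverse inv by (auto simp: M_def N_def)
  have "N ** Dmat D v = N ** (Dmat D v ** M) ** N"
    by (simp add: matrix_mul_assoc [symmetric] MN)
  also have "\<dots> = N ** (M ** Dmat D v) ** N"
    using leibniz_system_commute [OF sys eps(1) v] by (simp add: M_def)
  also have "\<dots> = Dmat D v ** N"
    by (simp add: matrix_mul_assoc MN)
  finally have ND: "N ** Dmat D v = Dmat D v ** N" .
  have X: "Xmat C D b v = N ** T"
    by (simp add: Xmat_def T_def N_def M_def cscale_mult_right
        bounded_bilinear.sum_right [OF bounded_bilinear_matrix_mult])
  have "N ** (dMmat C b v ** Dmat D v + cscale v (M ** E)) = N ** (Dmat D v ** dMmat C b v + T)"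
    using leibniz_system_deriv [OF sys eps(1) v] by (simp add: M_def E_def T_def)
  then have "N ** dMmat C b v ** Dmat D v + cscale v E = Dmat D v ** (N ** dMmat C b v) + N ** T"
    by (simp add: matrix_add_ldistrib matrix_mul_assoc cscale_mult_right MN ND)
  then have "N ** T = N ** dMmat C b v ** Dmat D v + cscale v E - Dmat D v ** (N ** dMmat C b v)"
    by simp
  then have "cscale (1 / v) (N ** T) = cscale (1 / v)
      (N ** dMmat C b v ** Dmat D v + cscale v E - Dmat D v ** (N ** dMmat C b v))"
    by (rule arg_cong)
  also have "\<dots> = E - cscale (- (1 / v)) (N ** dMmat C b v) ** Dmat D v
      + Dmat D v ** cscale (- (1 / v)) (N ** dMmat C b v)"
    unfolding cscale_mult_left cscale_mult_right using v0 by (simp add: vec_eq_iff field_simps)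
  finally show ?thesis
    by (simp add: X connection_def E_def N_def M_def)
qed

section \<open>Holomorphy of the connection and the integral formula\<close>

lemma Mmat_holomorphic:
  assumes "leibniz_system \<epsilon> C D" "0 < \<epsilon>"
  shows "(\<lambda>v. Mmat C b v 1 $ i $ j) holomorphic_on annulus \<epsilon>"
  using holomorphic2_on_compose [of "C i b j" "annulus \<epsilon> \<times> annulus \<epsilon>" "annulus \<epsilon>" "\<lambda>z. z" "\<lambda>_. 1"] assms
    one_in_annulus [OF assms(2)]
  by (auto simp: leibniz_system_def Mmat_def)

lemma dMmat_holomorphic:
  assumes "leibniz_system \<epsilon> C D" "0 < \<epsilon>"
  shows "(\<lambda>v. dMmat C b v $ i $ j) holomorphic_on annulus \<epsilon>"
  using holomorphic_on_deriv_snd [of "C i b j" "annulus \<epsilon>" "annulus \<epsilon>" 1] assms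
    one_in_annulus [OF assms(2)] open_annulus
  by (auto simp: leibniz_system_def dMmat_def)

lemma connection_holomorphic:
  assumes "leibniz_system \<epsilon> C D" "0 < \<epsilon>" "\<epsilon> < 1"
  shows "(\<lambda>v. connection C b v $ i $ j) holomorphic_on {v \<in> annulus \<epsilon>. invertible (Mmat C b v 1)}"
    (is "_ holomorphic_on ?T")
proof -
  have "(\<lambda>v. Mmat C b v 1 $ i $ j) holomorphic_on ?T" for i j
    using Mmat_holomorphic [OF assms(1,2)] by (rule holomorphic_on_subset) auto
  moreover have "(\<lambda>v. dMmat C b v $ i $ j) holomorphic_on ?T" for i j
    using dMmat_holomorphic [OF assms(1,2)] by (rule holomorphic_on_subset) auto
  ultimately show ?thesis
    unfolding connection_def cscale_nth using zero_notin_annulus [OF assms(3)]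
    by (intro holomorphic_intros holomorphic_on_matrix_mult holomorphic_on_matrix_inv) auto
qed

text \<open>Invertibility is assumed only on the path, whereas transport is constructed from a
  connection that is holomorphic on an open set.\<close>

lemma open_invertible_Mmat:
  assumes "leibniz_system \<epsilon> C D" "0 < \<epsilon>"
  shows "open {v \<in> annulus \<epsilon>. invertible (Mmat C b v 1)}"
proof -
  have "continuous_on (annulus \<epsilon>) (\<lambda>v. det (Mmat C b v 1))"
    by (intro holomorphic_on_imp_continuous_on holomorphic_on_det Mmat_holomorphic [OF assms])
  then have "open (annulus \<epsilon> \<inter> (\<lambda>v. det (Mmat C b v 1)) -` (- {0}))"
    by (intro continuous_open_preimage open_annulus) auto
  moreover have "{v \<in> annulus \<epsilon>. invertible (Mmat C b v 1)} =
      annulus \<epsilon> \<inter> (\<lambda>v. det (Mmat C b v 1)) -` (- {0})"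
    by (auto simp: invertible_det_nz)
  ultimately show ?thesis by simp
qed

text \<open>The antiderivative W D(\<gamma>) Y equals D(v) at parameter 1, where W = Y = I, and 0 at
  parameter 0, where D(1) = 0.\<close>

lemma Dmat_path_integral:
  assumes eps: "0 < \<epsilon>" "\<epsilon> < 1" and sys: "leibniz_system \<epsilon> C D"
    and \<gamma>: "valid_path \<gamma>" "path_image \<gamma> \<subseteq> annulus \<epsilon>" "pathstart \<gamma> = 1" "pathfinish \<gamma> = v"
    and inv: "\<forall>v'\<in>path_image \<gamma>. invertible (Mmat C b v' 1)"
  shows "\<And>t. t \<in> {0..1} \<Longrightarrow> path_transport \<gamma> (connection C b) t (\<lambda>s. Umat C b \<gamma> s t)"
    and "((\<lambda>t. cscale (vector_derivative \<gamma> (at t within {0..1}) / \<gamma> t)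
             (Umat C b \<gamma> 1 t ** Xmat C D b (\<gamma> t) ** matrix_inv (Umat C b \<gamma> 1 t)))
       has_integral Dmat D v) {0..1}"
proof -
  let ?B = "connection C b"
  obtain Y W where Y: "transport_on \<gamma> ?B 0 1 Y" and W: "cotransport_on \<gamma> ?B 0 1 W"
    and WY: "\<And>s. s \<in> {0..1} \<Longrightarrow> W s ** Y s = mat 1" and 1: "Y 1 = mat 1" "W 1 = mat 1"
  proof (rule transport_pair_exists)
    show "path_image \<gamma> \<subseteq> {v \<in> annulus \<epsilon>. invertible (Mmat C b v 1)}"
      using \<gamma>(2) inv by auto
  qed (use \<gamma>(1) open_invertible_Mmat [OF sys eps(1)] connection_holomorphic [OF sys eps] in auto)
  show "path_transport \<gamma> ?B t (\<lambda>s. Umat C b \<gamma> s t)" if "t \<in> {0..1}" for t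
    unfolding Umat_def by (rule path_transport_path_ordered_exp [OF Y W WY that])
  have U: "Umat C b \<gamma> 1 t = W t" "matrix_inv (W t) = Y t" if "t \<in> {0..1}" for t
    using path_ordered_exp_eq [of \<gamma> ?B Y W 1 t] Y W WY 1 that matrix_inv_unique [OF WY]
    by (simp_all add: Umat_def)
  have in_ann: "\<gamma> s \<in> annulus \<epsilon>" "invertible (Mmat C b (\<gamma> s) 1)" if "s \<in> {0..1}" for s
    using \<gamma>(2) inv that by (auto simp: path_image_def)
  obtain S0 where S0: "finite S0" "\<And>s. s \<in> {0..1} - S0 \<Longrightarrow> \<gamma> differentiable (at s)"
    and cont: "continuous_on {0..1} \<gamma>"
    using \<gamma>(1) unfolding valid_path_def piecewise_C1_differentiable_on_def
      C1_differentiable_on_eq by blast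
  obtain S1 where S1: "finite S1" "\<And>s. s \<in> {0..1} - S1 \<Longrightarrow>
      (Y has_vector_derivative cscale (vector_derivative \<gamma> (at s)) (?B (\<gamma> s) ** Y s)) (at s)"
    using Y unfolding transport_on_def by blast
  obtain S2 where S2: "finite S2" "\<And>s. s \<in> {0..1} - S2 \<Longrightarrow>
      (W has_vector_derivative cscale (vector_derivative \<gamma> (at s)) (- (W s ** ?B (\<gamma> s)))) (at s)"
    using W unfolding cotransport_on_def by blast
  have holD: "D a c holomorphic_on annulus \<epsilon>" for a c
    using sys by (simp add: leibniz_system_def)
  have contD: "continuous_on {0..1} (\<lambda>t. Dmat D (\<gamma> t))"
    unfolding Dmat_def using in_ann(1)
    by (intro continuous_on_vec_lambda
        continuous_on_compose2 [OF holomorphic_on_imp_continuous_on [OF holD] cont]) auto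
  \<comment> \<open>Including 0 and 1 lets the one-sided derivative of \<gamma> in the integrand be
    replaced by the two-sided one.\<close>
  define S where "S = S0 \<union> S1 \<union> S2 \<union> {0, 1}"
  let ?F = "\<lambda>t. W t ** Dmat D (\<gamma> t) ** Y t"
  have "(?F has_vector_derivative cscale (vector_derivative \<gamma> (at t within {0..1}) / \<gamma> t)
      (Umat C b \<gamma> 1 t ** Xmat C D b (\<gamma> t) ** matrix_inv (Umat C b \<gamma> 1 t))) (at t)"
    if t: "t \<in> {0..1} - S" for t
  proof -
    let ?g = "vector_derivative \<gamma> (at t)"
    define E :: "complex^'a^'a" where "E = (\<chi> a c. deriv (D a c) (\<gamma> t))"
    have t': "t \<in> {0..1}" "t \<in> {0..1} - S0" "t \<in> {0..1} - S1" "t \<in> {0..1} - S2" "0 < t" "t < 1"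
      using t by (auto simp: S_def)
    have g: "(\<gamma> has_vector_derivative ?g) (at t)"
      using S0(2) [OF t'(2)] vector_derivative_works by blast
    have D': "((\<lambda>t. Dmat D (\<gamma> t)) has_vector_derivative cscale ?g E) (at t)"
    proof (intro has_vector_derivative_vecI)
      fix a c
      have "(D a c has_field_derivative deriv (D a c) (\<gamma> t)) (at (\<gamma> t))"
        using holomorphic_derivI [OF holD open_annulus in_ann(1) [OF t'(1)]] .
      from field_vector_diff_chain_at [OF g this]
      show "((\<lambda>t. Dmat D (\<gamma> t) $ a $ c) has_vector_derivative cscale ?g E $ a $ c) (at t)"
        by (simp add: o_def Dmat_def E_def)
    qed
    note mult = bounded_bilinear.has_vector_derivative [OF bounded_bilinear_matrix_mult]
    \<comment> \<open>The product rule leaves W (E - B D + D B) Y times the speed, where B is the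
      connection; \<open>leibniz_system_ode\<close> identifies the bracket with X/\<gamma>.\<close>
    have "(?F has_vector_derivative
        (W t ** Dmat D (\<gamma> t)) ** cscale ?g (?B (\<gamma> t) ** Y t) +
        (W t ** cscale ?g E + cscale ?g (- (W t ** ?B (\<gamma> t))) ** Dmat D (\<gamma> t)) ** Y t) (at t)"
      by (intro mult [OF mult [OF S2(2) [OF t'(4)] D'] S1(2) [OF t'(3)]])
    also have "(W t ** Dmat D (\<gamma> t)) ** cscale ?g (?B (\<gamma> t) ** Y t) +
        (W t ** cscale ?g E + cscale ?g (- (W t ** ?B (\<gamma> t))) ** Dmat D (\<gamma> t)) ** Y t =
        cscale ?g (W t ** (E - ?B (\<gamma> t) ** Dmat D (\<gamma> t) + Dmat D (\<gamma> t) ** ?B (\<gamma> t)) ** Y t)"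
      by (simp add: cscale_mult_left cscale_mult_right cscale_add cscale_uminus matrix_mul_assoc
          matrix_add_ldistrib bounded_bilinear.add_left [OF bounded_bilinear_matrix_mult] matrix_mult_minus_left matrix_mult_minus_right
          diff_conv_add_uminus del: add_uminus_conv_diff)
    also have "\<dots> = cscale ?g (W t ** cscale (1 / \<gamma> t) (Xmat C D b (\<gamma> t)) ** Y t)"
      using leibniz_system_ode [OF sys eps in_ann(1) [OF t'(1)] in_ann(2) [OF t'(1)]]
      by (simp add: E_def)
    also have "\<dots> = cscale (?g / \<gamma> t) (W t ** Xmat C D b (\<gamma> t) ** Y t)"
      by (simp add: cscale_mult_left cscale_mult_right cscale_cscale)
    finally show ?thesis
      using t' by (simp add: U at_within_Icc_at)
  qed
  moreover have "continuous_on {0..1} ?F"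
    using Y W contD unfolding transport_on_def cotransport_on_def
    by (intro bounded_bilinear.continuous_on [OF bounded_bilinear_matrix_mult]) auto
  ultimately have "((\<lambda>t. cscale (vector_derivative \<gamma> (at t within {0..1}) / \<gamma> t)
      (Umat C b \<gamma> 1 t ** Xmat C D b (\<gamma> t) ** matrix_inv (Umat C b \<gamma> 1 t)))
      has_integral ?F 1 - ?F 0) {0..1}"
    using S0(1) S1(1) S2(1)
    by (intro fundamental_theorem_of_calculus_strong [where S = S]) (auto simp: S_def)
  moreover have "Dmat D (\<gamma> 0) = 0"
    using \<gamma>(3) sys by (simp add: pathstart_def Dmat_def vec_eq_iff leibniz_system_def)
  ultimately show "((\<lambda>t. cscale (vector_derivative \<gamma> (at t within {0..1}) / \<gamma> t)
      (Umat C b \<gamma> 1 t ** Xmat C D b (\<gamma> t) ** matrix_inv (Umat C b \<gamma> 1 t)))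
      has_integral Dmat D v) {0..1}"
    using \<gamma>(4) 1 by (simp add: pathfinish_def)
qed

text \<open>The first conjunct certifies that the description behind \<open>Umat\<close> denotes a
  genuine transport. In the second, \<gamma>'/\<gamma> dt stands for dv'/v'; the gauge integral
  copes with a speed that may be unbounded near exceptional parameters.\<close>

theorem mainTheorem4:
  fixes C :: "'n::finite \<Rightarrow> 'n \<Rightarrow> 'n \<Rightarrow> complex \<Rightarrow> complex \<Rightarrow> complex"
    and D :: "'n \<Rightarrow> 'n \<Rightarrow> complex \<Rightarrow> complex"
    and b :: 'n and \<epsilon> :: real and \<gamma> :: "real \<Rightarrow> complex" and v :: complex
  assumes "0 < \<epsilon>" and "\<epsilon> < 1"
    and "leibniz_system \<epsilon> C D"
    and "valid_path \<gamma>" and "path_image \<gamma> \<subseteq> annulus \<epsilon>"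
    and "pathstart \<gamma> = 1" and "pathfinish \<gamma> = v"
    and "\<forall>v'\<in>path_image \<gamma>. invertible (Mmat C b v' 1)"
  shows "(\<forall>t\<in>{0..1}. path_transport \<gamma> (connection C b) t (\<lambda>s. Umat C b \<gamma> s t)) \<and>
    ((\<lambda>t. cscale (vector_derivative \<gamma> (at t within {0..1}) / \<gamma> t)
             (Umat C b \<gamma> 1 t ** Xmat C D b (\<gamma> t) ** matrix_inv (Umat C b \<gamma> 1 t)))
       has_integral Dmat D v) {0..1} \<and>
    (\<forall>C' D'. leibniz_system \<epsilon> C' D' \<and>
       (\<forall>v'\<in>path_image \<gamma>. (\<forall>d. Mmat C' d v' 1 = Mmat C d v' 1) \<and> dMmat C' b v' = dMmat C b v') \<and>
       (\<forall>d. deriv (D' b d) 1 = deriv (D b d) 1) \<longrightarrow> Dmat D' v = Dmat D v)"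
proof (intro conjI ballI allI impI)
  note int = Dmat_path_integral(2) [OF assms]
  show "path_transport \<gamma> (connection C b) t (\<lambda>s. Umat C b \<gamma> s t)" if "t \<in> {0..1}" for t
    using Dmat_path_integral(1) [OF assms that] .
  show "((\<lambda>t. cscale (vector_derivative \<gamma> (at t within {0..1}) / \<gamma> t)
             (Umat C b \<gamma> 1 t ** Xmat C D b (\<gamma> t) ** matrix_inv (Umat C b \<gamma> 1 t)))
       has_integral Dmat D v) {0..1}"
    by (rule int)
  fix C' D'
  assume *: "leibniz_system \<epsilon> C' D' \<and>
       (\<forall>v'\<in>path_image \<gamma>. (\<forall>d. Mmat C' d v' 1 = Mmat C d v' 1) \<and> dMmat C' b v' = dMmat C b v') \<and>
       (\<forall>d. deriv (D' b d) 1 = deriv (D b d) 1)"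
  \<comment> \<open>Invertibility carries over, so the formula also holds for \<open>C'\<close> and
    \<open>D'\<close>. Its integrand uses only the shared data along the path, and an integral has a
    single value.\<close>
  then have inv': "\<forall>v'\<in>path_image \<gamma>. invertible (Mmat C' b v' 1)"
    using assms(8) by simp
  have in_path: "\<gamma> s \<in> path_image \<gamma>" if "s \<in> {0..1}" for s
    using that by (simp add: path_image_def)
  have "connection C' b (\<gamma> s) = connection C b (\<gamma> s)" if "s \<in> {0..1}" for s
    using * in_path [OF that] by (simp add: connection_def)
  then have U: "Umat C' b \<gamma> 1 t = Umat C b \<gamma> 1 t" for t
    unfolding Umat_def by (rule path_ordered_exp_cong)
  have X: "Xmat C' D' b (\<gamma> t) = Xmat C D b (\<gamma> t)" if "t \<in> {0..1}" for t
    using * in_path [OF that] by (simp add: Xmat_def)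
  have "((\<lambda>t. cscale (vector_derivative \<gamma> (at t within {0..1}) / \<gamma> t)
             (Umat C' b \<gamma> 1 t ** Xmat C' D' b (\<gamma> t) ** matrix_inv (Umat C' b \<gamma> 1 t)))
       has_integral Dmat D' v) {0..1}"
    using Dmat_path_integral(2) [OF assms(1,2) _ assms(4-7) inv'] * by blast
  then have "((\<lambda>t. cscale (vector_derivative \<gamma> (at t within {0..1}) / \<gamma> t)
             (Umat C b \<gamma> 1 t ** Xmat C D b (\<gamma> t) ** matrix_inv (Umat C b \<gamma> 1 t)))
       has_integral Dmat D' v) {0..1}"
    by (rule has_integral_eq [rotated]) (simp add: U X)
  then show "Dmat D' v = Dmat D v"
    using int by (rule has_integral_unique)
qed

end
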